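(* Let $X$ be either an oriented circle or an oriented interval. Then any $1$-dimensional cut-diagram over $X$ is cut-concordant to the empty cut-diagram over $X$ (the one with no cut-points).
   Context: **1-dimensional cut-diagrams.** Let $X$ be a compact oriented $1$-manifold. A $1$-dimensional cut-diagram over $X$ is a finite collection of pairwise distinct points in the interior of $X$, called cut-points, each endowed with a sign $\pm$ and labeled by a region, where regions are the connected components of $X$ minus all cut-points. There is no constraint on the labeling. **2-dimensional cut-diagrams.** Let $\Sigma$ be a compact oriented surface, possibly with boundary. A diagram on $\Sigma$ is a compact oriented $1$-manifold $P$ generically (not necessarily properly) immersed in $\Sigma$, with over/under information at each transverse double point (crossing); endpoints of $P$ may lie in the interior of $\Sigma$ (univalent vertices) or on $\partial\Sigma$. Regions are the connected components of $\Sigma\setminus P$; cut-arcs are the pieces into which $P$ is split by cutting it at all under-passages. A $2$-dimensional cut-diagram over $\Sigma$ is a diagram on $\Sigma$ with each cut-arc labeled by a region such that: (1) at each crossing where the over cut-arc is labeled $C$, and where the under cut-arc lying on the left (resp. right) of the oriented over-arc is labeled $A$ (resp. $B$), the regions $A$ and $B$ are adjacent along some $C$-labeled cut-arc having $A$ on its left and $B$ on its right; (2) a cut-arc containing a univalent vertex interior to $\Sigma$ and lying in region $A$ is labeled by $A$. **Cut-concordance.** Two cut-diagrams $\mathcal C_0,\mathcal C_1$ over $X$ are cut-concordant if there is a $2$-dimensional cut-diagram $\mathcal C$ over $X\times[0,1]$ (product orientation), called a cut-concordance between them, and homeomorphisms $f_\varepsilon:(X,\mathcal C_\varepsilon)\to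 (X\times\{\varepsilon\},\mathcal C\cap(X\times\{\varepsilon\}))$, $\varepsilon\in\{0,1\}$, preserving orientation (and sending each component $X_i$ of $X$ to $X_i\times\{\varepsilon\}$), such that: (Orientation) a cut-point of $\mathcal C_0$ (resp. $\mathcal C_1$) is mapped to an inward-oriented endpoint of a cut-arc if and only if its sign is positive (resp. negative); (Labeling) if a cut-point $p$ of $\mathcal C_\varepsilon$ is labeled by the region $r$, then the cut-arc of $\mathcal C$ containing $f_\varepsilon(p)$ is labeled by the region of $\mathcal C$ containing $f_\varepsilon(r)$; and, if $\partial X\ne\emptyset$, $\mathcal C\cap(\partial X\times[0,1])\cong f_\varepsilon(\mathcal C_0\cap\partial X)\times[0,1]$ (since cut-points are interior to $X$, this says that $\mathcal C$ is disjoint from $\partial X\times[0,1]$). *)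

theory Defs
  imports "HOL-Complex_Analysis.Complex_Analysis"
begin

text \<open>
  Everything lives in the topological category. A space comes with an atlas of charts
  \<open>(U, \<phi>)\<close>, where \<open>\<phi>\<close> maps the open set \<open>U\<close> homeomorphically onto a nondegenerate interval of the
  line (dimension 1), or onto a product of two such intervals in the plane (dimension 2). The
  intervals need not be open, so boundary points, and the corners of \<open>X \<times> [0,1]\<close>, are covered.
\<close>

type_synonym ('a, 'm) chart = "'a set \<times> ('a \<Rightarrow> 'm)"

record ('a, 'm) charted =
  space_of :: "'a topology"
  atlas :: "('a, 'm) chart set"

abbreviation pts :: "('a, 'm) charted \<Rightarrow> 'a set" where
  "pts M \<equiv> topspace (space_of M)"

definition intervals :: "real set set" where
  "intervals = {I. is_interval I \<and> interior I \<noteq> {}}"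

definition rect :: "real set \<Rightarrow> real set \<Rightarrow> complex set" where
  "rect I J = {z. Re z \<in> I \<and> Im z \<in> J}"

definition rects :: "complex set set" where
  "rects = {rect I J | I J. I \<in> intervals \<and> J \<in> intervals}"

definition is_chart ::
  "'m::topological_space set set \<Rightarrow> ('a, 'm) charted \<Rightarrow> ('a, 'm) chart \<Rightarrow> bool" where
  "is_chart models M = (\<lambda>(U, \<phi>). openin (space_of M) U \<and> \<phi> ` U \<in> models \<and>
     homeomorphic_map (subtopology (space_of M) U) (top_of_set (\<phi> ` U)) \<phi>)"

text \<open>Two charts of a curve are compatible if the change of coordinates is locally increasing.\<close>

definition compatible1 :: "('a, real) charted \<Rightarrow> ('a, real) chart \<Rightarrow> ('a, real) chart \<Rightarrow> bool" where
  "compatible1 M = (\<lambda>(U, \<phi>) (V, \<psi>). \<forall>x \<in> U \<inter> V. \<exists>W. openin (space_of M) W \<and> x \<in> W \<and> W \<subseteq> U \<inter> V \<and>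
     (\<forall>y \<in> W. \<forall>z \<in> W. \<phi> y < \<phi> z \<longleftrightarrow> \<psi> y < \<psi> z))"

text \<open>
  Two charts of a surface are compatible if the change of coordinates has local degree \<open>+1\<close> at
  every interior point: it maps a small positively oriented circle around \<open>\<phi> x\<close> to a loop that winds
  once around \<open>\<psi> x\<close>.
\<close>

definition compatible2 :: "('a, complex) chart \<Rightarrow> ('a, complex) chart \<Rightarrow> bool" where
  "compatible2 = (\<lambda>(U, \<phi>) (V, \<psi>). \<forall>x \<in> U \<inter> V. \<forall>r > 0. cball (\<phi> x) r \<subseteq> \<phi> ` (U \<inter> V) \<longrightarrow>
     winding_number (\<psi> \<circ> inv_into U \<phi> \<circ> circlepath (\<phi> x) r) (\<psi> x) = 1)"

definition positive_chart1 :: "('a, real) charted \<Rightarrow> ('a, real) chart \<Rightarrow> bool" where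
  "positive_chart1 M c \<longleftrightarrow> is_chart intervals M c \<and> (\<forall>d \<in> atlas M. compatible1 M c d)"

definition positive_chart2 :: "('a, complex) charted \<Rightarrow> ('a, complex) chart \<Rightarrow> bool" where
  "positive_chart2 M c \<longleftrightarrow> is_chart rects M c \<and> (\<forall>d \<in> atlas M. compatible2 c d)"

text \<open>Second countability follows from compactness and the existence of charts.\<close>

definition compact_oriented_curve :: "('a, real) charted \<Rightarrow> bool" where
  "compact_oriented_curve M \<longleftrightarrow> compact_space (space_of M) \<and> Hausdorff_space (space_of M) \<and>
     (\<Union>c \<in> atlas M. fst c) = pts M \<and> (\<forall>c \<in> atlas M. positive_chart1 M c)"

definition compact_oriented_surface :: "('a, complex) charted \<Rightarrow> bool" where
  "compact_oriented_surface M \<longleftrightarrow> compact_space (space_of M) \<and> Hausdorff_space (space_of M) \<and>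
     (\<Union>c \<in> atlas M. fst c) = pts M \<and> (\<forall>c \<in> atlas M. positive_chart2 M c)"

definition bdry :: "('a, 'm::topological_space) charted \<Rightarrow> 'a set" where
  "bdry M = {x. \<exists>(U, \<phi>) \<in> atlas M. x \<in> U \<and> \<phi> x \<notin> interior (\<phi> ` U)}"

text \<open>The boundary points at which an oriented curve starts.\<close>

definition initial_pts :: "('a, real) charted \<Rightarrow> 'a set" where
  "initial_pts M = {x. \<exists>(U, \<phi>) \<in> atlas M. x \<in> U \<and> (\<forall>y \<in> U. \<phi> x \<le> \<phi> y)}"

text \<open>The cylinder \<open>X \<times> [0,1]\<close> with the product orientation.\<close>

definition cylinder :: "('a, real) charted \<Rightarrow> ('a \<times> real, complex) charted" where
  "cylinder X = \<lparr>space_of = prod_topology (space_of X) (top_of_set {0..1}),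
     atlas = {(U \<times> {0..1}, \<lambda>(x, t). Complex (\<phi> x) t) | U \<phi>. (U, \<phi>) \<in> atlas X}\<rparr>"

datatype sign = Pos | Neg

text \<open>The domain of the map is the set of cut-points; the values are the signs and labels.\<close>

type_synonym 'a cut_diagram1 = "'a \<rightharpoonup> sign \<times> 'a set"

definition regions1 :: "('a, real) charted \<Rightarrow> 'a cut_diagram1 \<Rightarrow> 'a set set" where
  "regions1 X C = connected_components_of (subtopology (space_of X) (pts X - dom C))"

definition is_cut_diagram1 :: "('a, real) charted \<Rightarrow> 'a cut_diagram1 \<Rightarrow> bool" where
  "is_cut_diagram1 X C \<longleftrightarrow> finite (dom C) \<and> dom C \<subseteq> pts X - bdry X \<and>
     (\<forall>p s r. C p = Some (s, r) \<longrightarrow> r \<in> regions1 X C)"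

text \<open>
  A diagram is given by an abstract compact oriented curve (\<open>strands\<close>), its immersion \<open>imm\<close> into the
  surface, and the set \<open>unders\<close> of those points of the curve that are under-passages.
  Cut-arcs are subsets of the abstract curve, since two cut-arcs may cross in the surface.
\<close>

record ('p, 'b) cut_diagram2 =
  strands :: "('p, real) charted"
  imm :: "'p \<Rightarrow> 'b"
  unders :: "'p set"
  label :: "'p set \<Rightarrow> 'b set"

definition diagram_set :: "('p, 'b) cut_diagram2 \<Rightarrow> 'b set" where
  "diagram_set D = imm D ` pts (strands D)"

definition preim :: "('p, 'b) cut_diagram2 \<Rightarrow> 'b set \<Rightarrow> 'p set" where
  "preim D U = {w \<in> pts (strands D). imm D w \<in> U}"

text \<open>
  Local model at a point that is not a crossing: in a positive chart, the diagram runs from left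
  to right along the real axis. The point is an interior point of the strand, its start, or its end,
  according to whether the strand covers \<open>(-1,1)\<close>, \<open>[0,1)\<close>, or \<open>(-1,0]\<close>. In the last two cases it
  lies either in the interior of the surface (\<open>U\<close> is a full square) or on its boundary (\<open>U\<close> is a
  half-square with edge orthogonal to the strand).
\<close>

definition arc_chart ::
  "('b, complex) charted \<Rightarrow> ('p, 'b) cut_diagram2 \<Rightarrow> 'p \<Rightarrow> ('b, complex) chart \<Rightarrow> bool" where
  "arc_chart S D p = (\<lambda>(U, \<phi>).
     positive_chart2 S (U, \<phi>) \<and> p \<in> preim D U \<and> \<phi> (imm D p) = 0 \<and>
     (\<forall>w \<in> preim D U. Im (\<phi> (imm D w)) = 0) \<and>
     positive_chart1 (strands D) (preim D U, \<lambda>w. Re (\<phi> (imm D w))) \<and>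
     (\<exists>I \<in> {{-1<..<1}, {0..<1}, {-1<..0}}.
        (\<lambda>w. Re (\<phi> (imm D w))) ` preim D U = I \<and>
        (\<phi> ` U = rect {-1<..<1} {-1<..<1} \<or> \<phi> ` U = rect I {-1<..<1})))"

text \<open>
  Local model at a crossing with over-passage \<open>p\<close> and under-passage \<open>q\<close>: in a positive chart, the
  over-strand \<open>V\<close> runs from left to right along the real axis, and the under-strand \<open>W\<close> runs upwards
  or downwards along the imaginary axis. So the upper half is on the left of the over-strand.
\<close>

definition crossing_chart ::
  "('b, complex) charted \<Rightarrow> ('p, 'b) cut_diagram2 \<Rightarrow> 'p \<Rightarrow> 'p \<Rightarrow> 'p set \<Rightarrow> 'p set \<Rightarrow>
   ('b, complex) chart \<Rightarrow> bool" where
  "crossing_chart S D p q V W = (\<lambda>(U, \<phi>).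
     positive_chart2 S (U, \<phi>) \<and> \<phi> ` U = rect {-1<..<1} {-1<..<1} \<and>
     preim D U = V \<union> W \<and> V \<inter> W = {} \<and> p \<in> V \<and> q \<in> W \<and>
     \<phi> (imm D p) = 0 \<and> \<phi> (imm D q) = 0 \<and>
     V \<inter> unders D = {} \<and> W \<inter> unders D = {q} \<and>
     (\<forall>w \<in> V. Im (\<phi> (imm D w)) = 0) \<and>
     (\<lambda>w. Re (\<phi> (imm D w))) ` V = {-1<..<1} \<and>
     positive_chart1 (strands D) (V, \<lambda>w. Re (\<phi> (imm D w))) \<and>
     (\<forall>w \<in> W. Re (\<phi> (imm D w)) = 0) \<and>
     (\<lambda>w. Im (\<phi> (imm D w))) ` W = {-1<..<1} \<and>
     (positive_chart1 (strands D) (W, \<lambda>w. Im (\<phi> (imm D w))) \<or>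
      positive_chart1 (strands D) (W, \<lambda>w. - Im (\<phi> (imm D w)))))"

definition is_diagram :: "('b, complex) charted \<Rightarrow> ('p, 'b) cut_diagram2 \<Rightarrow> bool" where
  "is_diagram S D \<longleftrightarrow> compact_oriented_surface S \<and> compact_oriented_curve (strands D) \<and>
     unders D \<subseteq> pts (strands D) \<and>
     (\<forall>p \<in> pts (strands D).
        (p \<notin> unders D \<and> (\<exists>c. arc_chart S D p c)) \<or>
        (\<exists>q V W c. crossing_chart S D p q V W c) \<or>
        (\<exists>q V W c. crossing_chart S D q p V W c))"

definition regions2 :: "('b, complex) charted \<Rightarrow> ('p, 'b) cut_diagram2 \<Rightarrow> 'b set set" where
  "regions2 S D = connected_components_of (subtopology (space_of S) (pts S - diagram_set D))"

definition cut_arcs :: "('p, 'b) cut_diagram2 \<Rightarrow> 'p set set" where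
  "cut_arcs D =
     connected_components_of (subtopology (space_of (strands D)) (pts (strands D) - unders D))"

text \<open>
  Since a cut-arc may pass over other ones, the regions next to it can change along the cut-arc;
  it suffices that \<open>A\<close> (on the left) and \<open>B\<close> (on the right) meet at some point of it.
\<close>

definition adjacent_along ::
  "('b, complex) charted \<Rightarrow> ('p, 'b) cut_diagram2 \<Rightarrow> 'p set \<Rightarrow> 'b set \<Rightarrow> 'b set \<Rightarrow> bool" where
  "adjacent_along S D c A B \<longleftrightarrow> (\<exists>p \<in> c. \<exists>U \<phi>. arc_chart S D p (U, \<phi>) \<and>
     (\<lambda>w. Re (\<phi> (imm D w))) ` preim D U = {-1<..<1} \<and>
     {y \<in> U. Im (\<phi> y) > 0} \<subseteq> A \<and> {y \<in> U. Im (\<phi> y) < 0} \<subseteq> B)"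

definition crossing_condition :: "('b, complex) charted \<Rightarrow> ('p, 'b) cut_diagram2 \<Rightarrow> bool" where
  "crossing_condition S D \<longleftrightarrow> (\<forall>p q V W U \<phi>. crossing_chart S D p q V W (U, \<phi>) \<longrightarrow>
     (\<forall>over \<in> cut_arcs D. \<forall>left \<in> cut_arcs D. \<forall>right \<in> cut_arcs D.
        p \<in> over \<and> {w \<in> W. Im (\<phi> (imm D w)) > 0} \<subseteq> left \<and>
        {w \<in> W. Im (\<phi> (imm D w)) < 0} \<subseteq> right \<longrightarrow>
        (\<exists>c \<in> cut_arcs D. label D c = label D over \<and>
           adjacent_along S D c (label D left) (label D right))))"

text \<open>
  A univalent vertex in the interior of the surface is itself a point of the diagram; the region it
  lies in is the unique region having it in its closure.
\<close>

definition endpoint_condition :: "('b, complex) charted \<Rightarrow> ('p, 'b) cut_diagram2 \<Rightarrow> bool" where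
  "endpoint_condition S D \<longleftrightarrow> (\<forall>c \<in> cut_arcs D. \<forall>p \<in> c \<inter> bdry (strands D). \<forall>A \<in> regions2 S D.
     imm D p \<notin> bdry S \<and> imm D p \<in> space_of S closure_of A \<longrightarrow> label D c = A)"

definition is_cut_diagram2 :: "('b, complex) charted \<Rightarrow> ('p, 'b) cut_diagram2 \<Rightarrow> bool" where
  "is_cut_diagram2 S D \<longleftrightarrow> is_diagram S D \<and>
     (\<forall>c \<in> cut_arcs D. label D c \<in> regions2 S D) \<and>
     crossing_condition S D \<and> endpoint_condition S D"

text \<open>
  \<open>f\<close> identifies \<open>(X, C)\<close> with the end \<open>X \<times> {e}\<close> of the cut-diagram \<open>D\<close> on the cylinder, where \<open>s\<close> is
  the sign of those cut-points that correspond to inward-oriented endpoints.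
\<close>

definition concordance_end :: "('a, real) charted \<Rightarrow> ('p, 'a \<times> real) cut_diagram2 \<Rightarrow>
    real \<Rightarrow> sign \<Rightarrow> 'a cut_diagram1 \<Rightarrow> ('a \<Rightarrow> 'a \<times> real) \<Rightarrow> bool" where
  "concordance_end X D e s C f \<longleftrightarrow>
     homeomorphic_map (space_of X) (subtopology (space_of (cylinder X)) (pts X \<times> {e})) f \<and>
     f ` dom C = diagram_set D \<inter> (pts X \<times> {e}) \<and>
     (\<forall>(U, \<phi>) \<in> atlas X. positive_chart1 X ({x \<in> pts X. fst (f x) \<in> U}, \<lambda>x. \<phi> (fst (f x)))) \<and>
     (\<forall>K \<in> connected_components_of (space_of X). f ` K = K \<times> {e}) \<and>
     (\<forall>x t r. \<forall>w \<in> pts (strands D). C x = Some (t, r) \<and> imm D w = f x \<longrightarrow>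
        (w \<in> initial_pts (strands D) \<longleftrightarrow> t = s) \<and>
        (\<forall>c \<in> cut_arcs D. w \<in> c \<longrightarrow> f ` r \<subseteq> label D c))"

text \<open>
  The abstract curve underlying the concordance is carried by a set of complex numbers. This is no
  restriction: every compact curve is a finite disjoint union of circles and intervals, hence embeds
  into the plane.
\<close>

definition cut_concordant ::
  "('a, real) charted \<Rightarrow> 'a cut_diagram1 \<Rightarrow> 'a cut_diagram1 \<Rightarrow> bool" where
  "cut_concordant X C0 C1 \<longleftrightarrow> is_cut_diagram1 X C0 \<and> is_cut_diagram1 X C1 \<and>
     (\<exists>(D :: (complex, 'a \<times> real) cut_diagram2) f0 f1.
        is_cut_diagram2 (cylinder X) D \<and>
        concordance_end X D 0 Pos C0 f0 \<and> concordance_end X D 1 Neg C1 f1 \<and>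
        diagram_set D \<inter> (bdry X \<times> {0..1}) = {})"

end

theory Submission
  imports Defs
begin

text \<open>
  Over every cut-point \<open>p\<close> erect the vertical stub \<open>{p} \<times> [0,1/2]\<close>, oriented according to the sign of
  \<open>p\<close>. The stubs are disjoint and do not separate the cylinder, so there are no crossings and only
  one region. Hence all labels are forced to agree, and every labeling of the cut-points is
  respected.

  That products of positive charts of curves are positive charts of the product surface rests on one
  observation: if both coordinates are changed by increasing maps, then the displacement from the
  centre of a circle makes an acute angle with its image, so the image of the circle winds around
  the image of the centre exactly as the circle does around the centre.
\<close>

section \<open>Winding numbers\<close>

lemma winding_number_eq_if_inner_pos:
  assumes "path g" "path h" "pathfinish g = pathstart g" "pathfinish h = pathstart h"
    and inner_pos: "\<And>t. t \<in> {0..1} \<Longrightarrow> 0 < inner (g t - w) (h t - w)"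
  shows "winding_number g w = winding_number h w"
proof (rule winding_number_loops_linear_eq)
  fix t :: real
  assume "t \<in> {0..1}"
  define a b where "a = h t - w" and "b = g t - w"
  have ab: "0 < inner a b"
    using inner_pos[OF \<open>t \<in> {0..1}\<close>] by (simp add: a_def b_def inner_commute)
  show "w \<notin> closed_segment (h t) (g t)"
  proof
    assume "w \<in> closed_segment (h t) (g t)"
    then obtain s where s: "0 \<le> s" "s \<le> 1" "w = (1 - s) *\<^sub>R h t + s *\<^sub>R g t"
      unfolding closed_segment_def by blast
    then have "(1 - s) *\<^sub>R a + s *\<^sub>R b = 0"
      by (simp add: a_def b_def algebra_simps)
    then have "(1 - s) * inner a b + s * inner b b = 0"
      by (metis inner_add_left inner_scaleR_left inner_zero_left)
    moreover have "0 < inner b b"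
      using ab by auto
    ultimately show False
      using ab s(1,2) by (cases "s = 0") (auto simp: add_nonneg_eq_0_iff)
  qed
qed (use assms in auto)

lemma inner_pos_if_strict_mono_on:
  fixes f g :: "real \<Rightarrow> real"
  assumes f: "strict_mono_on S f" "Re z \<in> S" "Re w \<in> S"
    and g: "strict_mono_on T g" "Im z \<in> T" "Im w \<in> T" and "z \<noteq> w"
  shows "0 < inner (Complex (f (Re z)) (g (Im z)) - Complex (f (Re w)) (g (Im w))) (z - w)"
proof -
  have pos: "0 < (h x - h y) * (x - y)" if "strict_mono_on S h" "x \<in> S" "y \<in> S" "x \<noteq> y"
    for h :: "real \<Rightarrow> real" and S x y
    using that by (cases "x < y") (auto simp: zero_less_mult_iff dest: strict_mono_onD)
  have "Re z \<noteq> Re w \<or> Im z \<noteq> Im w"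
    using \<open>z \<noteq> w\<close> by (simp add: complex_eq_iff)
  then have "0 < (f (Re z) - f (Re w)) * (Re z - Re w) + (g (Im z) - g (Im w)) * (Im z - Im w)"
    using pos[OF f] pos[OF g] by (cases "Re z = Re w"; cases "Im z = Im w") auto
  then show ?thesis
    by (simp only: inner_complex_def minus_complex.sel complex.sel)
qed

lemma winding_number_circlepath_strict_mono:
  fixes f g :: "real \<Rightarrow> real"
  assumes "0 < r"
    and f: "continuous_on {Re z - r..Re z + r} f" "strict_mono_on {Re z - r..Re z + r} f"
    and g: "continuous_on {Im z - r..Im z + r} g" "strict_mono_on {Im z - r..Im z + r} g"
  shows "winding_number (\<lambda>t. Complex (f (Re (circlepath z r t))) (g (Im (circlepath z r t))))
           (Complex (f (Re z)) (g (Im z))) = 1"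
    (is "winding_number ?loop ?w = 1")
proof -
  let ?c = "circlepath z r"
  have dist: "norm (?c t - z) = r" for t
    using \<open>0 < r\<close> by (simp add: circlepath norm_mult)
  have Re: "Re (?c t) \<in> {Re z - r..Re z + r}" and Im: "Im (?c t) \<in> {Im z - r..Im z + r}" for t
    using abs_Re_le_cmod[of "?c t - z"] abs_Im_le_cmod[of "?c t - z"] dist[of t]
    by (auto simp: abs_le_iff)
  have "path ?c" "pathfinish ?c = pathstart ?c"
    by auto
  have "winding_number ?loop ?w = winding_number (circlepath ?w r) ?w"
  proof (rule winding_number_eq_if_inner_pos)
    show "path ?loop"
      unfolding path_def Complex_eq using \<open>path ?c\<close> Re Im
      by (intro continuous_intros continuous_on_compose2[OF f(1)] continuous_on_compose2[OF g(1)])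
        (auto simp: path_def)
    show "pathfinish ?loop = pathstart ?loop"
      using \<open>pathfinish ?c = pathstart ?c\<close> by (simp add: pathfinish_def pathstart_def)
    fix t
    have "?c t \<noteq> z"
      using dist[of t] \<open>0 < r\<close> by auto
    moreover have "circlepath ?w r t - ?w = ?c t - z"
      by (simp add: circlepath)
    ultimately show "0 < inner (?loop t - ?w) (circlepath ?w r t - ?w)"
      using inner_pos_if_strict_mono_on[OF f(2) Re _ g(2) Im] \<open>0 < r\<close> by simp
  qed auto
  then show ?thesis
    using \<open>0 < r\<close> by (simp add: winding_number_circlepath_centre)
qed

lemma shiftpath_circlepath:
  assumes "u = exp (2 * of_real pi * \<i> * of_real a)"
  shows "shiftpath a (circlepath z r) t = z + u * circlepath 0 r t"
proof -
  have "exp (2 * of_real pi * \<i> * of_real (a + t - 1)) = exp (2 * of_real pi * \<i> * of_real (a + t))"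
    using exp_integer_2pi[of 1] by (simp add: ring_distribs exp_diff mult.commute)
  then show ?thesis
    by (simp add: assms shiftpath_def circlepath ring_distribs exp_add mult_ac)
qed

lemma winding_number_circlepath_rotate:
  assumes u: "norm u = 1" and f: "continuous_on (sphere z \<bar>r\<bar>) f" "w \<notin> f ` sphere z \<bar>r\<bar>"
  shows "winding_number (\<lambda>t. f (z + u * circlepath 0 r t)) w
    = winding_number (f \<circ> circlepath z r) w"
proof -
  define a where "a = Arg2pi u / (2 * pi)"
  have a: "a \<in> {0..1}"
    using Arg2pi_ge_0[of u] Arg2pi_lt_2pi[of u] by (simp add: a_def)
  have "u = exp (2 * of_real pi * \<i> * of_real a)"
    using Arg2pi_eq[of u] u by (simp add: a_def mult_ac)
  then have "z + u * circlepath 0 r t = shiftpath a (circlepath z r) t" for t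
    by (rule shiftpath_circlepath[symmetric])
  then have "(\<lambda>t. f (z + u * circlepath 0 r t)) = shiftpath a (f \<circ> circlepath z r)"
    by (simp add: shiftpath_def fun_eq_iff)
  moreover have "winding_number (shiftpath a (f \<circ> circlepath z r)) w
      = winding_number (f \<circ> circlepath z r) w"
  proof (rule winding_number_shiftpath)
    show "path (f \<circ> circlepath z r)"
      using f(1) by (intro path_continuous_image) (auto simp: path_image_circlepath)
    show "w \<notin> path_image (f \<circ> circlepath z r)"
      using f(2) by (simp add: path_image_compose path_image_circlepath)
  qed (use a in \<open>auto simp: pathfinish_def pathstart_def circlepath\<close>)
  ultimately show ?thesis
    by simp
qed

section \<open>Intervals and rectangles\<close>

lemma strict_mono_on_Icc_if_locally:
  fixes f :: "real \<Rightarrow> 'b::order"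
  assumes "\<And>x. x \<in> {a..b} \<Longrightarrow> \<exists>e > 0. strict_mono_on ({a..b} \<inter> ball x e) f"
  shows "strict_mono_on {a..b} f"
proof (rule strict_mono_onI)
  fix x y
  assume xy: "x \<in> {a..b}" "y \<in> {a..b}" "x < y"
  have "x \<le> y"
    using xy(3) by simp
  then have "x < y \<longrightarrow> {x..y} \<subseteq> {a..b} \<longrightarrow> f x < f y"
  proof (induction rule: Bolzano)
    case (trans u v w)
    then show ?case
      by (cases "u = v"; cases "v = w") (auto intro: less_trans)
  next
    case (local z)
    then have "z \<in> {a..b}"
      using xy by auto
    then obtain e where "0 < e" and mono: "strict_mono_on ({a..b} \<inter> ball z e) f"
      using assms by blast
    have "f u < f v" if "u \<le> z" "z \<le> v" "v - u < e" "u < v" "{u..v} \<subseteq> {a..b}" for u v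
      using that by (intro strict_mono_onD[OF mono]) (auto simp: dist_real_def)
    then show ?case
      using \<open>0 < e\<close> by blast
  qed
  then show "f x < f y"
    using xy by auto
qed

lemma cball_subset_rectD:
  assumes "cball z r \<subseteq> rect I J" "0 \<le> r"
  shows "{Re z - r..Re z + r} \<subseteq> I" "{Im z - r..Im z + r} \<subseteq> J"
proof -
  have "Complex a (Im z) \<in> cball z r" if "a \<in> {Re z - r..Re z + r}" for a
    using that by (auto simp: dist_norm cmod_def abs_le_iff)
  then show "{Re z - r..Re z + r} \<subseteq> I"
    using assms(1) by (fastforce simp: rect_def)
  have "Complex (Re z) b \<in> cball z r" if "b \<in> {Im z - r..Im z + r}" for b
    using that by (auto simp: dist_norm cmod_def abs_le_iff)
  then show "{Im z - r..Im z + r} \<subseteq> J"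
    using assms(1) by (fastforce simp: rect_def)
qed

lemma unit_times_cases:
  fixes c :: real
  assumes "\<bar>c\<bar> = 1"
  shows "(*) c = id \<or> (*) c = uminus"
  using assms by (auto simp: fun_eq_iff abs_if split: if_splits)

lemma unit_times_image_intervals:
  assumes "\<bar>c\<bar> = 1" "I \<in> intervals"
  shows "(*) c ` I \<in> intervals"
proof -
  have "uminus ` I \<in> intervals"
    using assms(2) by (simp add: intervals_def interior_negations)
  then show ?thesis
    using unit_times_cases[OF assms(1)] assms(2) by auto
qed

text \<open>
  For \<open>d = \<plusminus>1\<close> this is the rotation by \<open>\<mp>\<pi>/2\<close>. It lays a vertical strand running upwards (\<open>d = 1\<close>) or
  downwards (\<open>d = -1\<close>) along the real axis, pointing to the right.
\<close>

definition quarter_turn :: "real \<Rightarrow> complex \<Rightarrow> complex" where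
  "quarter_turn d z = - of_real d * \<i> * z"

lemma quarter_turn_simps [simp]:
  "Re (quarter_turn d z) = d * Im z" "Im (quarter_turn d z) = - d * Re z"
  by (simp_all add: quarter_turn_def)

lemma quarter_turn_image_rect:
  assumes "\<bar>d\<bar> = 1"
  shows "quarter_turn d ` rect I J = rect ((*) d ` J) ((*) (- d) ` I)"
proof (intro set_eqI iffI)
  fix z
  assume "z \<in> rect ((*) d ` J) ((*) (- d) ` I)"
  then obtain a b where "a \<in> I" "b \<in> J" "z = Complex (d * b) (- d * a)"
    by (auto simp: rect_def complex_eq_iff)
  then show "z \<in> quarter_turn d ` rect I J"
    by (intro image_eqI[of _ _ "Complex a b"]) (auto simp: rect_def complex_eq_iff)
qed (auto simp: rect_def)

lemma quarter_turn_image_rects: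
  assumes "\<bar>d\<bar> = 1" "R \<in> rects"
  shows "quarter_turn d ` R \<in> rects"
proof -
  obtain I J where "R = rect I J" "I \<in> intervals" "J \<in> intervals"
    using assms(2) by (auto simp: rects_def)
  moreover have "(*) d ` J \<in> intervals" "(*) (- d) ` I \<in> intervals"
    using assms(1) calculation by (simp_all only: unit_times_image_intervals abs_minus_cancel)
  ultimately show ?thesis
    unfolding rects_def using quarter_turn_image_rect[OF assms(1)] by blast
qed

definition zoom :: "real \<Rightarrow> real \<Rightarrow> real \<Rightarrow> real" where
  "zoom a \<delta> t = (t - a) / \<delta>"

lemma zoom_less_iff: "0 < \<delta> \<Longrightarrow> zoom a \<delta> s < zoom a \<delta> t \<longleftrightarrow> s < t"
  by (simp add: zoom_def divide_less_cancel)

lemma zoom_image_ball: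
  assumes "0 < \<delta>"
  shows "zoom a \<delta> ` ball a \<delta> = {-1<..<1}"
proof (intro set_eqI iffI)
  fix y
  assume "y \<in> {-1<..<1::real}"
  then have "a + \<delta> * y \<in> ball a \<delta>"
    using assms by (simp add: dist_real_def abs_mult abs_less_iff)
  then show "y \<in> zoom a \<delta> ` ball a \<delta>"
    using assms by (intro image_eqI[of _ _ "a + \<delta> * y"]) (auto simp: zoom_def)
qed (use assms in \<open>auto simp: zoom_def dist_real_def field_simps\<close>)

lemma zoom_image_Icc_ball:
  assumes "0 < \<delta>"
  shows "zoom a \<delta> ` ({b..c} \<inter> ball a \<delta>) = {zoom a \<delta> b..zoom a \<delta> c} \<inter> {-1<..<1}"
proof -
  have "zoom a \<delta> ` {b..c} = {zoom a \<delta> b..zoom a \<delta> c}"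
  proof (intro set_eqI iffI)
    fix y
    assume "y \<in> {zoom a \<delta> b..zoom a \<delta> c}"
    then show "y \<in> zoom a \<delta> ` {b..c}"
      using assms by (intro image_eqI[of _ _ "a + \<delta> * y"]) (auto simp: zoom_def field_simps)
  qed (use assms in \<open>auto simp: zoom_def divide_le_cancel\<close>)
  moreover have "inj (zoom a \<delta>)"
    using assms by (auto simp: inj_def zoom_def)
  ultimately show ?thesis
    using zoom_image_ball[OF assms] by (simp add: image_Int)
qed

section \<open>Charts\<close>

lemma homeomorphic_map_top_of_setI:
  assumes "continuous_on S f" "continuous_on (f ` S) g" "\<And>x. x \<in> S \<Longrightarrow> g (f x) = x"
  shows "homeomorphic_map (top_of_set S) (top_of_set (f ` S)) f"
proof -
  have "homeomorphic_maps (top_of_set S) (top_of_set (f ` S)) f g"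
    using assms by (auto simp: homeomorphic_maps_def continuous_map_in_subtopology)
  then show ?thesis
    by (auto simp: homeomorphic_map_maps)
qed

lemma is_chartD:
  assumes "is_chart models M (U, \<phi>)"
  shows "openin (space_of M) U" "U \<subseteq> pts M" "\<phi> ` U \<in> models" "inj_on \<phi> U"
    and "homeomorphic_map (subtopology (space_of M) U) (top_of_set (\<phi> ` U)) \<phi>"
proof -
  show open_U: "openin (space_of M) U" and "\<phi> ` U \<in> models"
    and hom: "homeomorphic_map (subtopology (space_of M) U) (top_of_set (\<phi> ` U)) \<phi>"
    using assms by (auto simp: is_chart_def)
  show "U \<subseteq> pts M"
    using open_U by (rule openin_subset)
  then show "inj_on \<phi> U"
    using homeomorphic_imp_injective_map[OF hom] by (simp add: Int_absorb1)
qed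

lemma is_chart_comp_restrict:
  assumes "is_chart models M (U, \<phi>)" and N: "openin (space_of M) N" "N \<subseteq> U"
    and f: "homeomorphic_map (top_of_set (\<phi> ` N)) (top_of_set (f ` \<phi> ` N)) f"
    and "(\<lambda>x. f (\<phi> x)) ` N \<in> models'"
  shows "is_chart models' M (N, \<lambda>x. f (\<phi> x))"
proof -
  note chart = is_chartD[OF assms(1)]
  have "homeomorphic_map (subtopology (subtopology (space_of M) U) N)
      (subtopology (top_of_set (\<phi> ` U)) (\<phi> ` N)) \<phi>"
    using chart(2) N(2) by (intro homeomorphic_map_subtopologies[OF chart(5)]) auto
  then have "homeomorphic_map (subtopology (space_of M) N) (top_of_set (\<phi> ` N)) \<phi>"
    using N(2) by (simp add: subtopology_subtopology Int_absorb1 image_mono)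
  from homeomorphic_map_compose[OF this f] show ?thesis
    using assms by (simp add: is_chart_def o_def image_image)
qed

lemma openin_is_chart_preimage:
  assumes "is_chart models M (U, \<phi>)" "open S"
  shows "openin (space_of M) {x \<in> U. \<phi> x \<in> S}"
proof -
  note chart = is_chartD[OF assms(1)]
  have "continuous_map (subtopology (space_of M) U) euclidean \<phi>"
    using homeomorphic_imp_continuous_map[OF chart(5)] by (simp add: continuous_map_in_subtopology)
  then have "openin (subtopology (space_of M) U)
      {x \<in> topspace (subtopology (space_of M) U). \<phi> x \<in> S}"
    using assms(2) by (intro openin_continuous_map_preimage) auto
  then show ?thesis
    using chart(1,2) by (simp add: openin_open_subtopology Int_absorb1)
qed

lemma continuous_on_transition:
  assumes "is_chart models M (U, \<phi>)" "is_chart models' M (V, \<psi>)"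
  shows "continuous_on (\<phi> ` (U \<inter> V)) (\<psi> \<circ> inv_into U \<phi>)"
proof -
  note U = is_chartD[OF assms(1)] and V = is_chartD[OF assms(2)]
  obtain g where "homeomorphic_maps (subtopology (space_of M) U) (top_of_set (\<phi> ` U)) \<phi> g"
    using U(5) by (auto simp: homeomorphic_map_maps)
  then have g: "continuous_map (top_of_set (\<phi> ` U)) (space_of M) g" "\<And>x. x \<in> U \<Longrightarrow> g (\<phi> x) = x"
    using U(2) by (auto simp: homeomorphic_maps_def continuous_map_in_subtopology)
  have "continuous_map (top_of_set (\<phi> ` (U \<inter> V))) (subtopology (space_of M) V) g"
    using continuous_map_from_subtopology_mono[OF g(1), of "\<phi> ` (U \<inter> V)"] g(2)
    by (auto simp: continuous_map_in_subtopology)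
  moreover have "continuous_map (subtopology (space_of M) V) euclidean \<psi>"
    using homeomorphic_imp_continuous_map[OF V(5)] by (simp add: continuous_map_in_subtopology)
  ultimately have "continuous_on (\<phi> ` (U \<inter> V)) (\<psi> \<circ> g)"
    using continuous_map_compose by fastforce
  then show ?thesis
    by (rule continuous_on_eq) (use g(2) U(4) in auto)
qed

lemma inj_on_transition:
  assumes "is_chart models M (U, \<phi>)" "is_chart models' M (V, \<psi>)"
  shows "inj_on (\<psi> \<circ> inv_into U \<phi>) (\<phi> ` (U \<inter> V))"
  using is_chartD(4)[OF assms(1)] is_chartD(4)[OF assms(2)] by (auto simp: inj_on_def)

lemma strict_mono_on_transition:
  assumes "is_chart intervals M (U, \<phi>)" "compatible1 M (U, \<phi>) (V, \<psi>)"
    and "{a..b} \<subseteq> \<phi> ` (U \<inter> V)"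
  shows "strict_mono_on {a..b} (\<psi> \<circ> inv_into U \<phi>)"
proof (rule strict_mono_on_Icc_if_locally)
  note chart = is_chartD[OF assms(1)]
  fix s
  assume "s \<in> {a..b}"
  then obtain x where x: "x \<in> U \<inter> V" "s = \<phi> x"
    using assms(3) by blast
  obtain W where W: "openin (space_of M) W" "x \<in> W" "W \<subseteq> U \<inter> V"
    and order: "\<forall>y \<in> W. \<forall>z \<in> W. \<phi> y < \<phi> z \<longleftrightarrow> \<psi> y < \<psi> z"
    using assms(2) x(1) unfolding compatible1_def by blast
  have "openin (subtopology (space_of M) U) W"
    using W(1,3) chart(1) by (simp add: openin_open_subtopology)
  then have "openin (top_of_set (\<phi> ` U)) (\<phi> ` W)"
    using homeomorphic_imp_open_map[OF chart(5)] by (simp add: open_map_def)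
  then obtain e where "0 < e" "ball s e \<inter> \<phi> ` U \<subseteq> \<phi> ` W"
    using W(2) x(2) unfolding openin_contains_ball by blast
  then have ball: "{a..b} \<inter> ball s e \<subseteq> \<phi> ` W"
    using assms(3) by blast
  have "strict_mono_on (\<phi> ` W) (\<psi> \<circ> inv_into U \<phi>)"
    using W(3) chart(4) order
    by (intro strict_mono_onI) (auto simp: subset_iff)
  then have "strict_mono_on ({a..b} \<inter> ball s e) (\<psi> \<circ> inv_into U \<phi>)"
    using ball by (rule monotone_on_subset)
  then show "\<exists>e > 0. strict_mono_on ({a..b} \<inter> ball s e) (\<psi> \<circ> inv_into U \<phi>)"
    using \<open>0 < e\<close> by blast
qed

lemma positive_chart1_in_atlas:
  "compact_oriented_curve X \<Longrightarrow> c \<in> atlas X \<Longrightarrow> positive_chart1 X c"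
  by (simp add: compact_oriented_curve_def)

lemma positive_chart1_zoom:
  assumes chart: "positive_chart1 M (U, \<phi>)" and "0 < \<delta>"
    and N: "openin (space_of M) N" "N \<subseteq> U" "(\<lambda>x. zoom a \<delta> (\<phi> x)) ` N \<in> intervals"
  shows "positive_chart1 M (N, \<lambda>x. zoom a \<delta> (\<phi> x))"
  unfolding positive_chart1_def
proof (intro conjI ballI)
  have "homeomorphic_map (top_of_set S) (top_of_set (zoom a \<delta> ` S)) (zoom a \<delta>)" for S
    unfolding zoom_def using \<open>0 < \<delta>\<close>
    by (intro homeomorphic_map_top_of_setI[where g = "\<lambda>y. a + \<delta> * y"] continuous_intros) auto
  then show "is_chart intervals M (N, \<lambda>x. zoom a \<delta> (\<phi> x))"
    using chart N unfolding positive_chart1_def by (blast intro: is_chart_comp_restrict)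
  fix c
  assume "c \<in> atlas M"
  moreover obtain V \<psi> where c: "c = (V, \<psi>)"
    by fastforce
  ultimately have "compatible1 M (U, \<phi>) (V, \<psi>)"
    using chart by (simp add: positive_chart1_def)
  show "compatible1 M (N, \<lambda>x. zoom a \<delta> (\<phi> x)) c"
    unfolding c compatible1_def prod.case
  proof
    fix x
    assume "x \<in> N \<inter> V"
    then obtain W where "openin (space_of M) W" "x \<in> W" "W \<subseteq> U \<inter> V"
      "\<forall>y \<in> W. \<forall>z \<in> W. \<phi> y < \<phi> z \<longleftrightarrow> \<psi> y < \<psi> z"
      using \<open>compatible1 M (U, \<phi>) (V, \<psi>)\<close> N(2) unfolding compatible1_def by blast
    then show "\<exists>W. openin (space_of M) W \<and> x \<in> W \<and> W \<subseteq> N \<inter> V \<and>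
        (\<forall>y \<in> W. \<forall>z \<in> W. zoom a \<delta> (\<phi> y) < zoom a \<delta> (\<phi> z) \<longleftrightarrow> \<psi> y < \<psi> z)"
      using N(1) \<open>x \<in> N \<inter> V\<close> \<open>0 < \<delta>\<close>
      by (intro exI[of _ "W \<inter> N"]) (auto simp: zoom_less_iff)
  qed
qed

lemma isolating_ball:
  fixes y :: "'a::metric_space"
  assumes "y \<in> interior S" "finite F"
  obtains e where "0 < e" "ball y e \<subseteq> S" "ball y e \<inter> F \<subseteq> {y}"
proof -
  have "open (interior S - (F - {y}))"
    using assms(2) by (intro open_Diff open_interior finite_imp_closed) simp
  then obtain e where "0 < e" "ball y e \<subseteq> interior S - (F - {y})"
    using assms(1) by (metis Diff_iff open_contains_ball singletonI)
  then show ?thesis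
    using that[of e] interior_subset[of S] by blast
qed

lemma positive_chart1_around_interior_point:
  assumes X: "compact_oriented_curve X" and p: "p \<in> pts X - bdry X" and "finite F"
  obtains N \<alpha> where "positive_chart1 X (N, \<alpha>)" "\<alpha> ` N = {-1<..<1}" "p \<in> N" "\<alpha> p = 0" "N \<inter> F \<subseteq> {p}"
proof -
  obtain U \<phi> where U: "(U, \<phi>) \<in> atlas X" "p \<in> U"
    using X p unfolding compact_oriented_curve_def by fastforce
  have positive: "positive_chart1 X (U, \<phi>)"
    using positive_chart1_in_atlas[OF X U(1)] .
  then have chart: "is_chart intervals X (U, \<phi>)"
    by (simp add: positive_chart1_def)
  have "\<phi> p \<in> interior (\<phi> ` U)"
    using p U unfolding bdry_def by blast
  then obtain \<delta> where "0 < \<delta>" "ball (\<phi> p) \<delta> \<subseteq> \<phi> ` U" and isolated: "ball (\<phi> p) \<delta> \<inter> \<phi> ` F \<subseteq> {\<phi> p}"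
    using isolating_ball \<open>finite F\<close> by (metis finite_imageI)
  define N where "N = {x \<in> U. \<phi> x \<in> ball (\<phi> p) \<delta>}"
  have "\<phi> ` N = ball (\<phi> p) \<delta>"
    using \<open>ball (\<phi> p) \<delta> \<subseteq> \<phi> ` U\<close> by (auto simp: N_def)
  then have image: "(\<lambda>x. zoom (\<phi> p) \<delta> (\<phi> x)) ` N = {-1<..<1}"
    using zoom_image_ball[OF \<open>0 < \<delta>\<close>] by (metis image_image)
  show ?thesis
  proof (rule that)
    show "positive_chart1 X (N, \<lambda>x. zoom (\<phi> p) \<delta> (\<phi> x))"
    proof (rule positive_chart1_zoom[OF positive \<open>0 < \<delta>\<close>])
      show "openin (space_of X) N"
        unfolding N_def using chart open_ball by (rule openin_is_chart_preimage)
      show "(\<lambda>x. zoom (\<phi> p) \<delta> (\<phi> x)) ` N \<in> intervals"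
        unfolding image by (simp add: intervals_def is_interval_1)
    qed (auto simp: N_def)
    have "\<phi> q = \<phi> p" if "q \<in> N \<inter> F" for q
      using that isolated by (auto simp: N_def)
    then show "N \<inter> F \<subseteq> {p}"
      using U(2) is_chartD(4)[OF chart] by (auto simp: N_def dest: inj_onD)
  qed (use image U(2) \<open>0 < \<delta>\<close> in \<open>auto simp: N_def zoom_def\<close>)
qed

lemma compact_oriented_curve_if_disjoint_charts:
  assumes "compact_space (space_of M)" "Hausdorff_space (space_of M)"
    and "(\<Union>c \<in> atlas M. fst c) = pts M"
    and chart: "\<And>c. c \<in> atlas M \<Longrightarrow> is_chart intervals M c"
    and disjoint: "\<And>c d. c \<in> atlas M \<Longrightarrow> d \<in> atlas M \<Longrightarrow> c \<noteq> d \<Longrightarrow> fst c \<inter> fst d = {}"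
  shows "compact_oriented_curve M"
proof -
  have "compatible1 M c d" if "c \<in> atlas M" "d \<in> atlas M" for c d
  proof (cases "c = d")
    case True
    then show ?thesis
      using is_chartD(1) chart[OF that(1)] by (fastforce simp: compatible1_def)
  next
    case False
    then show ?thesis
      using disjoint[OF that] by (auto simp: compatible1_def)
  qed
  then show ?thesis
    using assms by (simp add: compact_oriented_curve_def positive_chart1_def)
qed

lemma cnj_mult_cancel_left: "norm u = 1 \<Longrightarrow> cnj u * (u * z) = z"
  using complex_norm_square[of u] by (simp add: mult.assoc[symmetric] mult.commute)

lemma cball_subset_if_mult_image:
  fixes u z :: complex
  assumes u: "norm u = 1" and cball: "cball (u * z) r \<subseteq> (*) u ` S"
  shows "cball z r \<subseteq> S"
proof -
  have "(*) u ` cball z r \<subseteq> cball (u * z) r"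
    using u by (auto simp: dist_norm norm_mult simp flip: right_diff_distrib)
  moreover have "inj ((*) u)"
    using u by (auto simp: inj_def)
  ultimately show ?thesis
    using cball by (metis inj_image_subset_iff subset_trans)
qed

lemma inv_into_mult_left:
  fixes \<phi> :: "'a \<Rightarrow> complex"
  assumes u: "norm u = 1" and \<phi>: "inj_on \<phi> U" and w: "w \<in> (\<lambda>x. u * \<phi> x) ` U"
  shows "inv_into U (\<lambda>x. u * \<phi> x) w = inv_into U \<phi> (cnj u * w)"
proof -
  obtain x where "x \<in> U" "w = u * \<phi> x"
    using w by blast
  moreover have "inj_on (\<lambda>x. u * \<phi> x) U"
    using u \<phi> by (auto simp: inj_on_def)
  ultimately show ?thesis
    using u \<phi> by (simp add: cnj_mult_cancel_left inv_into_f_f[of "\<lambda>x. u * \<phi> x"])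
qed

lemma compatible2_rotate:
  assumes U: "is_chart models M (U, \<phi>)" and V: "is_chart models' M (V, \<psi>)"
    and compatible: "compatible2 (U, \<phi>) (V, \<psi>)" and u: "norm u = 1"
  shows "compatible2 (U, \<lambda>x. u * \<phi> x) (V, \<psi>)"
  unfolding compatible2_def prod.case
proof (intro ballI allI impI)
  fix x and r :: real
  assume x: "x \<in> U \<inter> V" and "0 < r" and cball_u: "cball (u * \<phi> x) r \<subseteq> (\<lambda>x. u * \<phi> x) ` (U \<inter> V)"
  note inj = is_chartD(4)[OF U]
  define h where "h = \<psi> \<circ> inv_into U \<phi>"
  have loop: "\<psi> \<circ> inv_into U (\<lambda>x. u * \<phi> x) \<circ> circlepath (u * \<phi> x) r
      = (\<lambda>t. h (\<phi> x + cnj u * circlepath 0 r t))"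
  proof
    fix t
    have "circlepath (u * \<phi> x) r t \<in> cball (u * \<phi> x) r"
      using \<open>0 < r\<close> by (simp add: circlepath dist_norm norm_mult)
    then have "circlepath (u * \<phi> x) r t \<in> (\<lambda>x. u * \<phi> x) ` U"
      using cball_u by blast
    then show "(\<psi> \<circ> inv_into U (\<lambda>x. u * \<phi> x) \<circ> circlepath (u * \<phi> x) r) t
        = h (\<phi> x + cnj u * circlepath 0 r t)"
      using u inj
      by (simp add: h_def inv_into_mult_left circlepath distrib_left cnj_mult_cancel_left)
  qed
  have cball: "cball (\<phi> x) r \<subseteq> \<phi> ` (U \<inter> V)"
    by (rule cball_subset_if_mult_image[OF u]) (use cball_u in \<open>simp add: image_image\<close>)
  then have sphere: "sphere (\<phi> x) \<bar>r\<bar> \<subseteq> \<phi> ` (U \<inter> V)"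
    using \<open>0 < r\<close> by (auto simp: subset_iff)
  have "winding_number (\<lambda>t. h (\<phi> x + cnj u * circlepath 0 r t)) (\<psi> x)
      = winding_number (h \<circ> circlepath (\<phi> x) r) (\<psi> x)"
  proof (rule winding_number_circlepath_rotate)
    show "continuous_on (sphere (\<phi> x) \<bar>r\<bar>) h"
      unfolding h_def by (rule continuous_on_subset[OF continuous_on_transition[OF U V] sphere])
    have "h (\<phi> x) \<notin> h ` sphere (\<phi> x) \<bar>r\<bar>"
      unfolding h_def using inj_on_image_mem_iff[OF inj_on_transition[OF U V] _ sphere] x \<open>0 < r\<close>
      by auto
    then show "\<psi> x \<notin> h ` sphere (\<phi> x) \<bar>r\<bar>"
      using x inj by (simp add: h_def)
  qed (use u in simp)
  also have "\<dots> = 1"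
    using compatible x \<open>0 < r\<close> cball by (simp add: compatible2_def h_def)
  finally show
    "winding_number (\<psi> \<circ> inv_into U (\<lambda>x. u * \<phi> x) \<circ> circlepath (u * \<phi> x) r) (\<psi> x) = 1"
    unfolding loop .
qed

lemma positive_chart2_quarter_turn:
  assumes M: "compact_oriented_surface M" and U: "positive_chart2 M (U, \<phi>)" and d: "\<bar>d\<bar> = 1"
  shows "positive_chart2 M (U, \<lambda>x. quarter_turn d (\<phi> x))"
  unfolding positive_chart2_def
proof (intro conjI ballI)
  have chart: "is_chart rects M (U, \<phi>)"
    using U by (simp add: positive_chart2_def)
  have unit: "norm (- of_real d * \<i>) = 1"
    using d by (simp add: norm_mult)
  then have "homeomorphic_map (top_of_set S) (top_of_set (quarter_turn d ` S)) (quarter_turn d)"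
    for S
    unfolding quarter_turn_def
    by (intro homeomorphic_map_top_of_setI[where g = "\<lambda>z. z / (- of_real d * \<i>)"] continuous_intros)
      auto
  moreover have "(\<lambda>x. quarter_turn d (\<phi> x)) ` U \<in> rects"
    using quarter_turn_image_rects[OF d is_chartD(3)[OF chart]] by (simp add: image_image)
  ultimately show "is_chart rects M (U, \<lambda>x. quarter_turn d (\<phi> x))"
    using chart is_chartD(1)[OF chart] by (intro is_chart_comp_restrict[OF chart]) auto
  fix c
  assume "c \<in> atlas M"
  then have "positive_chart2 M c" "compatible2 (U, \<phi>) c"
    using M U by (auto simp: compact_oriented_surface_def positive_chart2_def)
  then show "compatible2 (U, \<lambda>x. quarter_turn d (\<phi> x)) c"
    unfolding quarter_turn_def
    using compatible2_rotate[OF chart _ _ unit, of rects "fst c" "snd c"]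
    by (simp add: positive_chart2_def)
qed

section \<open>Products of curves\<close>

definition times_chart :: "('a, real) chart \<Rightarrow> ('b, real) chart \<Rightarrow> ('a \<times> 'b, complex) chart" where
  "times_chart = (\<lambda>(U, \<phi>) (V, \<psi>). (U \<times> V, \<lambda>(x, y). Complex (\<phi> x) (\<psi> y)))"

definition product_surface ::
  "('a, real) charted \<Rightarrow> ('b, real) charted \<Rightarrow> ('a \<times> 'b, complex) charted" where
  "product_surface X Y = \<lparr>space_of = prod_topology (space_of X) (space_of Y),
     atlas = \<Union>c \<in> atlas X. times_chart c ` atlas Y\<rparr>"

lemma fst_times_chart: "fst (times_chart c d) = fst c \<times> fst d"
  by (simp add: times_chart_def case_prod_unfold)

lemma Complex_image_Times: "(\<lambda>(x, y). Complex (\<phi> x) (\<psi> y)) ` (A \<times> B) = rect (\<phi> ` A) (\<psi> ` B)"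
  by (force simp: rect_def complex_eq_iff)

lemma inv_into_Complex_Times:
  assumes "inj_on \<phi> U" "inj_on \<psi> V" and z: "z \<in> rect (\<phi> ` U) (\<psi> ` V)"
  shows "inv_into (U \<times> V) (\<lambda>(x, y). Complex (\<phi> x) (\<psi> y)) z
    = (inv_into U \<phi> (Re z), inv_into V \<psi> (Im z))"
proof -
  obtain x y where "x \<in> U" "y \<in> V" and z: "z = Complex (\<phi> x) (\<psi> y)"
    using z by (auto simp: rect_def complex_eq_iff)
  moreover have "inj_on (\<lambda>(x, y). Complex (\<phi> x) (\<psi> y)) (U \<times> V)"
    using assms(1,2) by (auto simp: inj_on_def)
  ultimately show ?thesis
    using inv_into_f_f[of "\<lambda>(x, y). Complex (\<phi> x) (\<psi> y)" "U \<times> V" "(x, y)"] assms(1,2) by simp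
qed

lemma homeomorphic_map_prod:
  assumes "homeomorphic_map X X' f" "homeomorphic_map Y Y' g"
  shows "homeomorphic_map (prod_topology X Y) (prod_topology X' Y') (\<lambda>(x, y). (f x, g y))"
proof -
  obtain f' g' where "homeomorphic_maps X X' f f'" "homeomorphic_maps Y Y' g g'"
    using assms by (auto simp: homeomorphic_map_maps)
  then have "homeomorphic_maps (prod_topology X Y) (prod_topology X' Y')
      (\<lambda>(x, y). (f x, g y)) (\<lambda>(x, y). (f' x, g' y))"
    by (simp add: homeomorphic_maps_prod)
  then show ?thesis
    by (rule homeomorphic_maps_imp_map)
qed

lemma is_chart_times_chart:
  assumes "is_chart intervals X c" "is_chart intervals Y d"
  shows "is_chart rects (product_surface X Y) (times_chart c d)"
proof -
  obtain U \<phi> V \<psi> where cd: "c = (U, \<phi>)" "d = (V, \<psi>)"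
    by fastforce
  note U = is_chartD[OF assms(1)[unfolded cd]] and V = is_chartD[OF assms(2)[unfolded cd]]
  have "homeomorphic_map (top_of_set (\<phi> ` U \<times> \<psi> ` V))
      (top_of_set ((\<lambda>(a, b). Complex a b) ` (\<phi> ` U \<times> \<psi> ` V))) (\<lambda>(a, b). Complex a b)"
    unfolding Complex_eq case_prod_unfold
    by (intro homeomorphic_map_top_of_setI[where g = "\<lambda>z. (Re z, Im z)"] continuous_intros) auto
  moreover have "(\<lambda>(a, b). Complex a b) ` (\<phi> ` U \<times> \<psi> ` V) = rect (\<phi> ` U) (\<psi> ` V)"
    using Complex_image_Times[of "\<lambda>a. a" "\<lambda>b. b"] by simp
  ultimately have "homeomorphic_map
      (prod_topology (subtopology (space_of X) U) (subtopology (space_of Y) V))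
      (top_of_set (rect (\<phi> ` U) (\<psi> ` V)))
      ((\<lambda>(a, b). Complex a b) \<circ> (\<lambda>(x, y). (\<phi> x, \<psi> y)))"
    using homeomorphic_map_prod[OF U(5) V(5)]
    by (intro homeomorphic_map_compose[of _ "top_of_set (\<phi> ` U \<times> \<psi> ` V)"]) simp_all
  then have "homeomorphic_map (subtopology (space_of (product_surface X Y)) (U \<times> V))
      (top_of_set (rect (\<phi> ` U) (\<psi> ` V))) (\<lambda>(x, y). Complex (\<phi> x) (\<psi> y))"
    by (simp add: product_surface_def subtopology_Times o_def case_prod_unfold)
  moreover have "openin (space_of (product_surface X Y)) (U \<times> V)"
    using U(1) V(1) by (simp add: product_surface_def openin_prod_Times_iff)
  moreover have "rect (\<phi> ` U) (\<psi> ` V) \<in> rects"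
    using U(3) V(3) unfolding rects_def by blast
  ultimately show ?thesis
    by (simp add: is_chart_def times_chart_def cd Complex_image_Times)
qed

lemma compatible2_times_chart:
  assumes X: "is_chart intervals X (U, \<phi>)" "is_chart intervals X (V, \<psi>)"
      "compatible1 X (U, \<phi>) (V, \<psi>)"
    and Y: "is_chart intervals Y (U', \<phi>')" "is_chart intervals Y (V', \<psi>')"
      "compatible1 Y (U', \<phi>') (V', \<psi>')"
  shows "compatible2 (times_chart (U, \<phi>) (U', \<phi>')) (times_chart (V, \<psi>) (V', \<psi>'))"
  unfolding compatible2_def times_chart_def prod.case
proof (intro ballI allI impI)
  let ?\<Phi> = "\<lambda>(x, y). Complex (\<phi> x) (\<phi>' y)" and ?\<Psi> = "\<lambda>(x, y). Complex (\<psi> x) (\<psi>' y)"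
  let ?h = "\<psi> \<circ> inv_into U \<phi>" and ?h' = "\<psi>' \<circ> inv_into U' \<phi>'"
  fix p and r :: real
  assume p: "p \<in> U \<times> U' \<inter> V \<times> V'" and "0 < r"
    and "cball (?\<Phi> p) r \<subseteq> ?\<Phi> ` (U \<times> U' \<inter> V \<times> V')"
  then have cball: "cball (?\<Phi> p) r \<subseteq> rect (\<phi> ` (U \<inter> V)) (\<phi>' ` (U' \<inter> V'))"
    by (simp add: Times_Int_Times Complex_image_Times)
  note sides = cball_subset_rectD[OF this less_imp_le[OF \<open>0 < r\<close>]]
  note inj = is_chartD(4)[OF X(1)] is_chartD(4)[OF Y(1)]
  have "?\<Psi> \<circ> inv_into (U \<times> U') ?\<Phi> \<circ> circlepath (?\<Phi> p) r
      = (\<lambda>t. Complex (?h (Re (circlepath (?\<Phi> p) r t))) (?h' (Im (circlepath (?\<Phi> p) r t))))"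
  proof
    fix t
    have "circlepath (?\<Phi> p) r t \<in> cball (?\<Phi> p) r"
      using \<open>0 < r\<close> by (simp add: circlepath dist_norm norm_mult)
    then have "circlepath (?\<Phi> p) r t \<in> rect (\<phi> ` U) (\<phi>' ` U')"
      using cball by (auto simp: rect_def)
    then show "(?\<Psi> \<circ> inv_into (U \<times> U') ?\<Phi> \<circ> circlepath (?\<Phi> p) r) t
        = Complex (?h (Re (circlepath (?\<Phi> p) r t))) (?h' (Im (circlepath (?\<Phi> p) r t)))"
      by (simp only: o_apply inv_into_Complex_Times[OF inj] prod.case)
  qed
  moreover have "?\<Psi> p = Complex (?h (Re (?\<Phi> p))) (?h' (Im (?\<Phi> p)))"
    using p inj by auto
  ultimately show "winding_number (?\<Psi> \<circ> inv_into (U \<times> U') ?\<Phi> \<circ> circlepath (?\<Phi> p) r) (?\<Psi> p) = 1"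
    using winding_number_circlepath_strict_mono[OF \<open>0 < r\<close>
        continuous_on_subset[OF continuous_on_transition[OF X(1,2)] sides(1)]
        strict_mono_on_transition[OF X(1,3) sides(1)]
        continuous_on_subset[OF continuous_on_transition[OF Y(1,2)] sides(2)]
        strict_mono_on_transition[OF Y(1,3) sides(2)]]
    by (simp only:)
qed

lemma positive_chart2_times_chart:
  assumes "compact_oriented_curve X" "positive_chart1 X c"
    and "compact_oriented_curve Y" "positive_chart1 Y d"
  shows "positive_chart2 (product_surface X Y) (times_chart c d)"
  unfolding positive_chart2_def
proof (intro conjI ballI)
  show "is_chart rects (product_surface X Y) (times_chart c d)"
    using assms by (simp add: is_chart_times_chart positive_chart1_def)
  fix e
  assume "e \<in> atlas (product_surface X Y)"
  then obtain c' d' where "e = times_chart c' d'" "c' \<in> atlas X" "d' \<in> atlas Y"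
    by (auto simp: product_surface_def)
  then show "compatible2 (times_chart c d) e"
    using assms compatible2_times_chart[of X "fst c" "snd c" "fst c'" "snd c'"
        Y "fst d" "snd d" "fst d'" "snd d'"]
    by (simp add: positive_chart1_def compact_oriented_curve_def)
qed

lemma compact_oriented_surface_product_surface:
  assumes X: "compact_oriented_curve X" and Y: "compact_oriented_curve Y"
  shows "compact_oriented_surface (product_surface X Y)"
proof -
  have "(\<Union>e \<in> atlas (product_surface X Y). fst e)
      = (\<Union>c \<in> atlas X. fst c) \<times> (\<Union>d \<in> atlas Y. fst d)"
    by (simp add: product_surface_def fst_times_chart SUP_UNION image_image) blast
  moreover have "positive_chart2 (product_surface X Y) e" if "e \<in> atlas (product_surface X Y)" for e
    using that X Y positive_chart2_times_chart[of X _ Y]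
    by (auto simp: product_surface_def compact_oriented_curve_def)
  ultimately show ?thesis
    using X Y
    by (simp add: compact_oriented_surface_def compact_oriented_curve_def product_surface_def
        compact_space_prod_topology Hausdorff_space_prod_topology)
qed

lemma connectedin_Times_Diff_Times:
  assumes X: "connected_space X" and Y: "connected_space Y" "connectedin Y (topspace Y - B)"
    and B: "topspace Y - B \<noteq> {}"
  shows "connectedin (prod_topology X Y) (topspace X \<times> topspace Y - A \<times> B)"
proof -
  let ?T = "topspace X \<times> (topspace Y - B)"
  define \<U> where "\<U> = insert ?T ((\<lambda>x. ?T \<union> {x} \<times> topspace Y) ` (topspace X - A))"
  have T: "connectedin (prod_topology X Y) ?T"
    using X Y(2) by (simp add: connectedin_Times connectedin_topspace)
  show ?thesis
  proof (cases "topspace X = {}")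
    case False
    have "connectedin (prod_topology X Y) (\<Union>\<U>)"
    proof (rule connectedin_Union)
      fix S
      assume "S \<in> \<U>"
      then consider "S = ?T" | x where "x \<in> topspace X" "S = ?T \<union> {x} \<times> topspace Y"
        unfolding \<U>_def by blast
      then show "connectedin (prod_topology X Y) S"
      proof cases
        case 2
        have "connectedin (prod_topology X Y) ({x} \<times> topspace Y)"
          using 2(1) Y(1) by (simp add: connectedin_Times connectedin_topspace)
        moreover have "?T \<inter> {x} \<times> topspace Y \<noteq> {}"
          using 2(1) B by blast
        ultimately show ?thesis
          unfolding 2(2) using T by (intro connectedin_Un)
      qed (use T in simp)
    next
      show "\<Inter>\<U> \<noteq> {}"
        using False B by (auto simp: \<U>_def)
    qed
    moreover have "\<Union>\<U> = topspace X \<times> topspace Y - A \<times> B"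
      unfolding \<U>_def by blast
    ultimately show ?thesis
      by simp
  qed simp
qed

section \<open>The cylinder\<close>

definition unit_interval :: "(real, real) charted" where
  "unit_interval = \<lparr>space_of = top_of_set {0..1}, atlas = {({0..1}, \<lambda>t. t)}\<rparr>"

lemma compact_oriented_unit_interval: "compact_oriented_curve unit_interval"
proof (rule compact_oriented_curve_if_disjoint_charts)
  have "{0..1} \<in> intervals"
    by (simp add: intervals_def is_interval_cc)
  moreover have "homeomorphic_map (top_of_set {0..1::real}) (top_of_set {0..1}) (\<lambda>t. t)"
    using homeomorphic_map_id[of "top_of_set {0..1::real}"] by (simp add: id_def)
  ultimately show "is_chart intervals unit_interval c" if "c \<in> atlas unit_interval" for c
    using that by (auto simp: unit_interval_def is_chart_def subtopology_subtopology)
qed (auto simp: unit_interval_def compact_space_subtopology Hausdorff_space_subtopology)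

lemma cylinder_eq_product_surface: "cylinder X = product_surface X unit_interval"
  by (auto simp: cylinder_def product_surface_def unit_interval_def times_chart_def)

lemma compact_oriented_surface_cylinder:
  "compact_oriented_curve X \<Longrightarrow> compact_oriented_surface (cylinder X)"
  unfolding cylinder_eq_product_surface
  using compact_oriented_unit_interval by (rule compact_oriented_surface_product_surface[rotated])

lemma positive_chart2_cylinder:
  assumes X: "compact_oriented_curve X" "positive_chart1 X (N, \<alpha>)"
    and zoom: "0 < \<delta>" "zoom a \<delta> ` ({0..1} \<inter> ball a \<delta>) \<in> intervals" and d: "\<bar>d\<bar> = 1"
  shows "positive_chart2 (cylinder X)
    (N \<times> ({0..1} \<inter> ball a \<delta>), \<lambda>y. quarter_turn d (case y of (x, t) \<Rightarrow> Complex (\<alpha> x) (zoom a \<delta> t)))"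
proof -
  have "positive_chart1 unit_interval ({0..1}, \<lambda>t. t)"
    by (rule positive_chart1_in_atlas[OF compact_oriented_unit_interval])
      (simp add: unit_interval_def)
  then have "positive_chart1 unit_interval ({0..1} \<inter> ball a \<delta>, zoom a \<delta>)"
    using positive_chart1_zoom[of unit_interval "{0..1}" "\<lambda>t. t" \<delta> "{0..1} \<inter> ball a \<delta>" a] zoom
    by (simp add: unit_interval_def openin_open_Int)
  then have "positive_chart2 (cylinder X) (times_chart (N, \<alpha>) ({0..1} \<inter> ball a \<delta>, zoom a \<delta>))"
    unfolding cylinder_eq_product_surface
    by (rule positive_chart2_times_chart[OF X compact_oriented_unit_interval])
  then show ?thesis
    using d compact_oriented_surface_cylinder[OF X(1)]
    by (intro positive_chart2_quarter_turn) (auto simp: times_chart_def)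
qed

lemma homeomorphic_map_cylinder_slice:
  assumes "e \<in> {0..1}"
  shows "homeomorphic_map (space_of X)
      (subtopology (space_of (cylinder X)) (pts X \<times> {e})) (\<lambda>x. (x, e))"
proof -
  have "homeomorphic_maps (space_of X)
      (subtopology (space_of (cylinder X)) (pts X \<times> {e})) (\<lambda>x. (x, e)) fst"
    using assms unfolding homeomorphic_maps_def cylinder_def
    by (auto simp: continuous_map_in_subtopology continuous_map_pairwise o_def
        continuous_map_from_subtopology continuous_map_fst)
  then show ?thesis
    by (auto simp: homeomorphic_map_maps)
qed

lemma concordance_end_slice:
  assumes X: "compact_oriented_curve X" and e: "e \<in> {0..1}"
    and "diagram_set D \<inter> (pts X \<times> {e}) = dom C \<times> {e}"
    and cut_points: "\<And>x t r w. C x = Some (t, r) \<Longrightarrow> w \<in> pts (strands D) \<Longrightarrow> imm D w = (x, e) \<Longrightarrow>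
      (w \<in> initial_pts (strands D) \<longleftrightarrow> t = s) \<and>
      (\<forall>c \<in> cut_arcs D. w \<in> c \<longrightarrow> r \<times> {e} \<subseteq> label D c)"
  shows "concordance_end X D e s C (\<lambda>x. (x, e))"
proof -
  have slice: "(\<lambda>x. (x, e)) ` K = K \<times> {e}" for K :: "'a set"
    by auto
  show ?thesis
    unfolding concordance_end_def fst_conv slice
  proof (intro conjI)
    show "\<forall>(U, \<phi>) \<in> atlas X. positive_chart1 X ({x \<in> pts X. x \<in> U}, \<phi>)"
    proof clarify
      fix U \<phi>
      assume "(U, \<phi>) \<in> atlas X"
      then have positive: "positive_chart1 X (U, \<phi>)"
        using X by (rule positive_chart1_in_atlas[rotated])
      then have "U \<subseteq> pts X"
        unfolding positive_chart1_def by (blast dest: is_chartD(2))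
      then show "positive_chart1 X ({x \<in> pts X. x \<in> U}, \<phi>)"
        using positive by (simp add: Collect_conj_eq Int_absorb1)
    qed
    show "homeomorphic_map (space_of X)
      (subtopology (space_of (cylinder X)) (pts X \<times> {e})) (\<lambda>x. (x, e))"
      using e by (rule homeomorphic_map_cylinder_slice)
  qed (use assms(3) cut_points in \<open>simp_all, blast\<close>)
qed

section \<open>Erecting stubs\<close>

definition arc_intervals :: "real set set" where
  "arc_intervals = {{-1<..<1}, {0..<1}, {-1<..0}}"

lemma arc_intervals_subset_intervals: "arc_intervals \<subseteq> intervals"
  by (auto simp: arc_intervals_def intervals_def is_interval_1)

lemma unit_times_image_open_unit_interval:
  fixes c :: real
  assumes "\<bar>c\<bar> = 1"
  shows "(*) c ` {-1<..<1} = {-1<..<1}"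
  using unit_times_cases[OF assms] by auto

lemma unit_times_image_arc_intervals:
  assumes "\<bar>c\<bar> = 1" "I \<in> arc_intervals"
  shows "(*) c ` I \<in> arc_intervals"
  using unit_times_cases[OF assms(1)] assms(2) by (auto simp: arc_intervals_def)

lemma stub_window:
  fixes a :: real
  assumes "a \<in> {0..1/2}"
  obtains \<delta> where "0 < \<delta>" "zoom a \<delta> ` ({0..1/2} \<inter> ball a \<delta>) \<in> arc_intervals"
    "zoom a \<delta> ` ({0..1} \<inter> ball a \<delta>) \<in> {{-1<..<1}, zoom a \<delta> ` ({0..1/2} \<inter> ball a \<delta>)}"
proof -
  consider "a = 0" | "0 < a" "a < 1/2" | "a = 1/2"
    using assms by force
  then show ?thesis
  proof cases
    case 1
    have "zoom a (1/2) ` ({0..c} \<inter> ball a (1/2)) = {0..<1}" if "1/2 \<le> c" for c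
      using 1 that by (subst zoom_image_Icc_ball) (auto simp: zoom_def)
    then show ?thesis
      by (intro that[of "1/2"]) (simp_all add: arc_intervals_def)
  next
    case 2
    define \<delta> where "\<delta> = min a (1/2 - a)"
    have \<delta>: "0 < \<delta>" "\<delta> \<le> a" "\<delta> \<le> 1/2 - a"
      using 2 by (auto simp: \<delta>_def)
    have "zoom a \<delta> ` ({0..c} \<inter> ball a \<delta>) = {-1<..<1}" if "1/2 \<le> c" for c
    proof -
      have "zoom a \<delta> 0 \<le> -1" "1 \<le> zoom a \<delta> c"
        using \<delta> that by (auto simp: zoom_def field_simps)
      then show ?thesis
        using \<delta>(1) by (subst zoom_image_Icc_ball) auto
    qed
    then show ?thesis
      using \<delta>(1) by (intro that[of \<delta>]) (simp_all add: arc_intervals_def)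
  next
    case 3
    have "zoom a (1/2) ` ({0..1/2} \<inter> ball a (1/2)) = {-1<..0}"
      "zoom a (1/2) ` ({0..1} \<inter> ball a (1/2)) = {-1<..<1}"
      using 3 by (subst zoom_image_Icc_ball; auto simp: zoom_def)+
    then show ?thesis
      by (intro that[of "1/2"]) (simp_all add: arc_intervals_def)
  qed
qed

locale stubs =
  fixes X :: "('a, real) charted" and C :: "'a cut_diagram1" and abscissa :: "'a \<Rightarrow> real"
  assumes curve: "compact_oriented_curve X" and connected: "connected_space (space_of X)"
    and diagram: "is_cut_diagram1 X C" and inj_abscissa: "inj_on abscissa (dom C)"

begin

definition stub :: "'a \<Rightarrow> complex set" where
  "stub p = Complex (abscissa p) ` {0..1/2}"

definition direction :: "'a \<Rightarrow> real" where
  "direction p = (if fst (the (C p)) = Pos then 1 else -1)"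

definition stub_curve :: "(complex, real) charted" where
  "stub_curve = \<lparr>space_of = top_of_set (\<Union>p \<in> dom C. stub p),
     atlas = (\<lambda>p. (stub p, \<lambda>z. direction p * Im z)) ` dom C\<rparr>"

definition region :: "('a \<times> real) set" where
  "region = pts X \<times> {0..1} - dom C \<times> {0..1/2}"

definition stub_diagram :: "(complex, 'a \<times> real) cut_diagram2" where
  "stub_diagram = \<lparr>strands = stub_curve, imm = \<lambda>z. (inv_into (dom C) abscissa (Re z), Im z),
     unders = {}, label = \<lambda>_. region\<rparr>"

lemma abs_direction: "\<bar>direction p\<bar> = 1"
  by (simp add: direction_def)

lemma finite_dom: "finite (dom C)" and dom_subset: "dom C \<subseteq> pts X - bdry X"
  using diagram by (auto simp: is_cut_diagram1_def)

lemma stub_disjoint: "p \<in> dom C \<Longrightarrow> q \<in> dom C \<Longrightarrow> p \<noteq> q \<Longrightarrow> stub p \<inter> stub q = {}"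
  using inj_abscissa by (auto simp: stub_def dest: inj_onD)

lemma compact_stub: "compact (stub p)"
  unfolding stub_def Complex_eq by (intro compact_continuous_image continuous_intros) auto

lemma openin_stub:
  assumes "p \<in> dom C"
  shows "openin (space_of stub_curve) (stub p)"
proof -
  have "closed (\<Union>q \<in> dom C - {p}. stub q)"
    using finite_dom compact_stub by (auto intro!: compact_imp_closed)
  moreover have "stub p = (\<Union>q \<in> dom C. stub q) \<inter> - (\<Union>q \<in> dom C - {p}. stub q)"
    using assms stub_disjoint by blast
  ultimately show ?thesis
    unfolding stub_curve_def charted.simps by (metis openin_open_Int open_Compl)
qed

lemma is_chart_stub:
  assumes "p \<in> dom C"
  shows "is_chart intervals stub_curve (stub p, \<lambda>z. direction p * Im z)"
proof -
  let ?d = "direction p"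
  have "homeomorphic_map (top_of_set (stub p)) (top_of_set ((\<lambda>z. ?d * Im z) ` stub p))
      (\<lambda>z. ?d * Im z)"
  proof (rule homeomorphic_map_top_of_setI[where g = "\<lambda>s. Complex (abscissa p) (?d * s)"])
    show "continuous_on ((\<lambda>z. ?d * Im z) ` stub p) (\<lambda>s. Complex (abscissa p) (?d * s))"
      unfolding Complex_eq by (intro continuous_intros)
  qed (auto simp: stub_def direction_def intro!: continuous_intros)
  moreover have "subtopology (space_of stub_curve) (stub p) = top_of_set (stub p)"
    using assms by (simp add: stub_curve_def subtopology_subtopology Int_absorb1 UN_upper)
  moreover have "(*) ?d ` {0..1/2} \<in> intervals"
    using abs_direction
    by (rule unit_times_image_intervals) (simp add: intervals_def is_interval_cc)
  then have "(\<lambda>z. ?d * Im z) ` stub p \<in> intervals"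
    by (simp add: stub_def image_image)
  ultimately show ?thesis
    using openin_stub[OF assms] by (simp add: is_chart_def)
qed

lemma compact_oriented_stub_curve: "compact_oriented_curve stub_curve"
proof (rule compact_oriented_curve_if_disjoint_charts)
  show "compact_space (space_of stub_curve)"
    using finite_dom compact_stub
    by (simp add: stub_curve_def compact_space_subtopology compact_UN)
  show "is_chart intervals stub_curve c" if "c \<in> atlas stub_curve" for c
    using that is_chart_stub by (auto simp: stub_curve_def)
  show "fst c \<inter> fst d = {}"
    if cd: "c \<in> atlas stub_curve" "d \<in> atlas stub_curve" "c \<noteq> d" for c d
  proof -
    obtain p q where "p \<in> dom C" "c = (stub p, \<lambda>z. direction p * Im z)"
      and "q \<in> dom C" "d = (stub q, \<lambda>z. direction q * Im z)"
      using cd(1,2) unfolding stub_curve_def charted.simps by (elim imageE)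
    then show ?thesis
      using stub_disjoint[of p q] cd(3) by fastforce
  qed
qed (auto simp: stub_curve_def Hausdorff_space_subtopology)

lemma positive_chart1_stub:
  assumes p: "p \<in> dom C" and "0 < \<delta>" and zoom: "zoom a \<delta> ` ({0..1/2} \<inter> ball a \<delta>) \<in> intervals"
  shows "positive_chart1 stub_curve
    (Complex (abscissa p) ` ({0..1/2} \<inter> ball a \<delta>), \<lambda>z. direction p * zoom a \<delta> (Im z))"
proof -
  let ?d = "direction p" and ?N = "Complex (abscissa p) ` ({0..1/2} \<inter> ball a \<delta>)"
  have "positive_chart1 stub_curve (stub p, \<lambda>z. ?d * Im z)"
    using p by (intro positive_chart1_in_atlas[OF compact_oriented_stub_curve])
      (simp add: stub_curve_def)
  moreover have "?N = stub p \<inter> Im -` ball a \<delta>"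
    by (auto simp: stub_def)
  then have "openin (space_of stub_curve) ?N" "?N \<subseteq> stub p"
    using openin_stub[OF p] by (auto simp: stub_curve_def intro!: openin_Int_open open_vimage
        continuous_intros)
  moreover have "zoom (?d * a) \<delta> (?d * t) = ?d * zoom a \<delta> t" for t
    by (simp add: zoom_def right_diff_distrib)
  moreover have "(\<lambda>z. ?d * zoom a \<delta> (Im z)) ` ?N = (*) ?d ` zoom a \<delta> ` ({0..1/2} \<inter> ball a \<delta>)"
    by (simp add: image_image)
  then have "(\<lambda>z. ?d * zoom a \<delta> (Im z)) ` ?N \<in> intervals"
    using unit_times_image_intervals[OF abs_direction zoom] by simp
  ultimately show ?thesis
    using positive_chart1_zoom[OF _ \<open>0 < \<delta>\<close>, of stub_curve "stub p" "\<lambda>z. ?d * Im z" ?N "?d * a"]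
    by simp
qed

lemma stub_diagram_simps [simp]:
  "strands stub_diagram = stub_curve" "unders stub_diagram = {}" "label stub_diagram c = region"
  by (simp_all add: stub_diagram_def)

lemma imm_stub_diagram: "p \<in> dom C \<Longrightarrow> imm stub_diagram (Complex (abscissa p) t) = (p, t)"
  using inj_abscissa by (simp add: stub_diagram_def)

lemma pts_stub_curve:
  "pts stub_curve = (\<lambda>(p, t). Complex (abscissa p) t) ` (dom C \<times> {0..1/2})"
  by (simp add: stub_curve_def stub_def image_def) blast

lemma stub_curve_pointE:
  assumes "w \<in> pts stub_curve"
  obtains p t where "p \<in> dom C" "t \<in> {0..1/2}" "w = Complex (abscissa p) t"
  using assms that unfolding pts_stub_curve by (elim imageE SigmaE) simp

lemma diagram_set_stub_diagram: "diagram_set stub_diagram = dom C \<times> {0..1/2}"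
proof -
  have "diagram_set stub_diagram
      = (\<lambda>(p, t). imm stub_diagram (Complex (abscissa p) t)) ` (dom C \<times> {0..1/2})"
    by (simp add: diagram_set_def pts_stub_curve image_image case_prod_unfold)
  also have "\<dots> = (\<lambda>y. y) ` (dom C \<times> {0..1/2})"
    by (rule image_cong) (use imm_stub_diagram in fastforce)+
  finally show ?thesis
    by simp
qed

lemma preim_stub_diagram:
  assumes p: "p \<in> dom C" "p \<in> N" "N \<inter> dom C \<subseteq> {p}"
  shows "preim stub_diagram (N \<times> J) = Complex (abscissa p) ` ({0..1/2} \<inter> J)"
proof (intro set_eqI iffI)
  fix w
  assume "w \<in> preim stub_diagram (N \<times> J)"
  then have "w \<in> pts stub_curve" "imm stub_diagram w \<in> N \<times> J"
    by (simp_all add: preim_def)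
  then obtain q t where "q \<in> dom C" "t \<in> {0..1/2}" "w = Complex (abscissa q) t" "q \<in> N" "t \<in> J"
    by (metis imm_stub_diagram mem_Sigma_iff stub_curve_pointE)
  then show "w \<in> Complex (abscissa p) ` ({0..1/2} \<inter> J)"
    using p(3) by blast
next
  fix w
  assume "w \<in> Complex (abscissa p) ` ({0..1/2} \<inter> J)"
  then obtain t where t: "t \<in> {0..1/2}" "t \<in> J" "w = Complex (abscissa p) t"
    by blast
  then have "w \<in> pts stub_curve"
    unfolding pts_stub_curve using p(1) by (intro image_eqI[of _ _ "(p, t)"]) simp_all
  then show "w \<in> preim stub_diagram (N \<times> J)"
    using p t by (simp add: preim_def imm_stub_diagram)
qed

lemma arc_chart_stub_diagram:
  assumes p: "p \<in> dom C" and a: "a \<in> {0..1/2}"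
    and N: "positive_chart1 X (N, \<alpha>)" "\<alpha> ` N = {-1<..<1}" "p \<in> N" "\<alpha> p = 0" "N \<inter> dom C \<subseteq> {p}"
    and \<delta>: "0 < \<delta>" and arc: "zoom a \<delta> ` ({0..1/2} \<inter> ball a \<delta>) \<in> arc_intervals"
    and square: "zoom a \<delta> ` ({0..1} \<inter> ball a \<delta>) \<in> {{-1<..<1}, zoom a \<delta> ` ({0..1/2} \<inter> ball a \<delta>)}"
  shows "arc_chart (cylinder X) stub_diagram (Complex (abscissa p) a) (N \<times> ({0..1} \<inter> ball a \<delta>),
    \<lambda>y. quarter_turn (direction p) (case y of (x, t) \<Rightarrow> Complex (\<alpha> x) (zoom a \<delta> t)))"
    (is "arc_chart _ _ ?w (?U, ?\<Phi>)")
proof -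
  let ?d = "direction p"
  define I where "I = (*) ?d ` zoom a \<delta> ` ({0..1/2} \<inter> ball a \<delta>)"
  have Re_imm: "Re (?\<Phi> (imm stub_diagram z)) = ?d * zoom a \<delta> (Im z)" for z
    by (simp add: stub_diagram_def)
  have "{0..1/2} \<inter> ({0..1} \<inter> ball a \<delta>) = {0..1/2} \<inter> ball a \<delta>"
    by auto
  then have preim: "preim stub_diagram ?U = Complex (abscissa p) ` ({0..1/2} \<inter> ball a \<delta>)"
    using preim_stub_diagram[OF p N(3,5)] by simp
  have "?\<Phi> ` ?U = quarter_turn ?d ` (\<lambda>(x, t). Complex (\<alpha> x) (zoom a \<delta> t)) ` ?U"
    by (simp add: image_image)
  also have "\<dots> = rect ((*) ?d ` zoom a \<delta> ` ({0..1} \<inter> ball a \<delta>)) ((*) (- ?d) ` \<alpha> ` N)"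
    by (simp only: Complex_image_Times quarter_turn_image_rect[OF abs_direction])
  finally have "?\<Phi> ` ?U = rect {-1<..<1} {-1<..<1} \<or> ?\<Phi> ` ?U = rect I {-1<..<1}"
    using square unit_times_image_open_unit_interval[of ?d]
      unit_times_image_open_unit_interval[of "- ?d"] abs_direction[of p]
    by (auto simp: N(2) I_def)
  moreover have "(\<lambda>z. Re (?\<Phi> (imm stub_diagram z))) ` preim stub_diagram ?U = I"
    unfolding Re_imm preim I_def image_image complex.sel ..
  moreover have "I \<in> {{-1<..<1}, {0..<1}, {-1<..0}}"
    using unit_times_image_arc_intervals[OF abs_direction arc]
    by (simp add: I_def arc_intervals_def)
  moreover have "{-1<..<1} \<in> intervals"
    using arc_intervals_subset_intervals by (auto simp: arc_intervals_def)
  then have "positive_chart2 (cylinder X) (?U, ?\<Phi>)"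
    using arc square arc_intervals_subset_intervals
    by (intro positive_chart2_cylinder[OF curve N(1) \<delta> _ abs_direction]) auto
  moreover have "positive_chart1 (strands stub_diagram)
      (preim stub_diagram ?U, \<lambda>z. Re (?\<Phi> (imm stub_diagram z)))"
    unfolding Re_imm preim stub_diagram_simps using arc arc_intervals_subset_intervals
    by (intro positive_chart1_stub[OF p \<delta>]) blast
  moreover have "?w \<in> preim stub_diagram ?U" "?\<Phi> (imm stub_diagram ?w) = 0"
    using p a \<delta> N(4) by (auto simp: preim imm_stub_diagram complex_eq_iff zoom_def)
  moreover have "\<forall>z \<in> preim stub_diagram ?U. Im (?\<Phi> (imm stub_diagram z)) = 0"
    using p N(4) by (auto simp: preim imm_stub_diagram)
  ultimately show ?thesis
    unfolding arc_chart_def prod.case by blast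
qed

lemma arc_chart_exists_stub_diagram:
  assumes "w \<in> pts stub_curve"
  shows "\<exists>c. arc_chart (cylinder X) stub_diagram w c"
proof -
  obtain p a where p: "p \<in> dom C" and a: "a \<in> {0..1/2}" and w: "w = Complex (abscissa p) a"
    using stub_curve_pointE[OF assms] .
  obtain N \<alpha> where "positive_chart1 X (N, \<alpha>)" "\<alpha> ` N = {-1<..<1}" "p \<in> N" "\<alpha> p = 0" "N \<inter> dom C \<subseteq> {p}"
    using positive_chart1_around_interior_point[OF curve _ finite_dom] p dom_subset by blast
  moreover obtain \<delta> where "0 < \<delta>" "zoom a \<delta> ` ({0..1/2} \<inter> ball a \<delta>) \<in> arc_intervals"
    "zoom a \<delta> ` ({0..1} \<inter> ball a \<delta>) \<in> {{-1<..<1}, zoom a \<delta> ` ({0..1/2} \<inter> ball a \<delta>)}"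
    using stub_window[OF a] .
  ultimately show ?thesis
    using arc_chart_stub_diagram[OF p a] w by blast
qed

lemma regions2_stub_diagram:
  "regions2 (cylinder X) stub_diagram = (if region = {} then {} else {region})"
proof -
  have "{0..1} - {0..1/2} = {1/2<..1::real}"
    by auto
  then have "connectedin (space_of (cylinder X)) region"
    using connectedin_Times_Diff_Times[OF connected, of "top_of_set {0..1}" "{0..1/2::real}" "dom C"]
    by (simp add: cylinder_def region_def connectedin_subtopology connected_space_subtopology
        subset_iff)
  then have "connected_space (subtopology (space_of (cylinder X)) region)"
    "topspace (subtopology (space_of (cylinder X)) region) = region"
    by (auto simp: connectedin_def cylinder_def)
  then have "connected_components_of (subtopology (space_of (cylinder X)) region)
      = (if region = {} then {} else {region})"
    by (metis connected_components_of_connected_space null_topspace_iff_trivial)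
  then show ?thesis
    by (simp add: regions2_def diagram_set_stub_diagram region_def cylinder_def)
qed

lemma is_cut_diagram2_stub_diagram: "is_cut_diagram2 (cylinder X) stub_diagram"
  unfolding is_cut_diagram2_def
proof (intro conjI ballI)
  show "is_diagram (cylinder X) stub_diagram"
    unfolding is_diagram_def using compact_oriented_surface_cylinder[OF curve]
      compact_oriented_stub_curve arc_chart_exists_stub_diagram
    by simp
  show "crossing_condition (cylinder X) stub_diagram"
    by (simp add: crossing_condition_def crossing_chart_def)
  show "endpoint_condition (cylinder X) stub_diagram"
    by (simp add: endpoint_condition_def regions2_stub_diagram)
  fix c
  assume "c \<in> cut_arcs stub_diagram"
  then have "c \<noteq> {}" "c \<subseteq> pts stub_curve"
    unfolding cut_arcs_def
    using nonempty_connected_components_of connected_components_of_subset by fastforce+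
  then obtain p where "p \<in> dom C"
    by (meson all_not_in_conv stub_curve_pointE subsetD)
  then have "(p, 1) \<in> region"
    using dom_subset by (auto simp: region_def)
  then show "label stub_diagram c \<in> regions2 (cylinder X) stub_diagram"
    by (auto simp: regions2_stub_diagram)
qed

lemma initial_pts_stub_curve:
  assumes "p \<in> dom C"
  shows "Complex (abscissa p) 0 \<in> initial_pts stub_curve \<longleftrightarrow> fst (the (C p)) = Pos"
proof -
  have "Complex (abscissa p) 0 \<in> stub q \<longleftrightarrow> q = p" if "q \<in> dom C" for q
    using assms that inj_abscissa by (auto simp: stub_def dest: inj_onD)
  then have "Complex (abscissa p) 0 \<in> initial_pts stub_curve \<longleftrightarrow> (\<forall>t \<in> {0..1/2}. 0 \<le> direction p * t)"
    using assms by (auto simp: initial_pts_def stub_curve_def) (auto simp: stub_def)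
  also have "\<dots> \<longleftrightarrow> direction p = 1"
    by (auto simp: direction_def intro!: bexI[of _ "1/2"])
  finally show ?thesis
    by (simp add: direction_def)
qed

lemma concordance_end_0: "concordance_end X stub_diagram 0 Pos C (\<lambda>x. (x, 0))"
proof (rule concordance_end_slice[OF curve])
  show "diagram_set stub_diagram \<inter> (pts X \<times> {0}) = dom C \<times> {0}"
    using dom_subset by (auto simp: diagram_set_stub_diagram)
  fix x t r w
  assume C: "C x = Some (t, r)"
    and "w \<in> pts (strands stub_diagram)" "imm stub_diagram w = (x, 0)"
  then have "w = Complex (abscissa x) 0"
    by (metis imm_stub_diagram prod.inject stub_curve_pointE stub_diagram_simps(1))
  then have "w \<in> initial_pts (strands stub_diagram) \<longleftrightarrow> t = Pos"
    using initial_pts_stub_curve[of x] C by (simp add: domI)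
  moreover have "r \<in> regions1 X C"
    using diagram C by (auto simp: is_cut_diagram1_def)
  then have "r \<subseteq> pts X - dom C"
    unfolding regions1_def using connected_components_of_subset by fastforce
  then have "r \<times> {0} \<subseteq> region"
    by (auto simp: region_def)
  ultimately show "(w \<in> initial_pts (strands stub_diagram) \<longleftrightarrow> t = Pos) \<and>
      (\<forall>c \<in> cut_arcs stub_diagram. w \<in> c \<longrightarrow> r \<times> {0} \<subseteq> label stub_diagram c)"
    by simp
qed simp

lemma concordance_end_1: "concordance_end X stub_diagram 1 Neg Map.empty (\<lambda>x. (x, 1))"
  by (rule concordance_end_slice[OF curve]) (auto simp: diagram_set_stub_diagram)

lemma cut_concordant_empty: "cut_concordant X C Map.empty"
proof -
  have "is_cut_diagram1 X Map.empty"
    by (simp add: is_cut_diagram1_def)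
  moreover have "diagram_set stub_diagram \<inter> (bdry X \<times> {0..1}) = {}"
    using dom_subset by (auto simp: diagram_set_stub_diagram)
  ultimately show ?thesis
    unfolding cut_concordant_def
    using diagram is_cut_diagram2_stub_diagram concordance_end_0 concordance_end_1 by blast
qed

end

lemma cut_concordant_empty_if_connected:
  assumes X: "compact_oriented_curve X" "connected_space (space_of X)" and C: "is_cut_diagram1 X C"
  shows "cut_concordant X C Map.empty"
proof -
  have "finite (dom C)"
    using C by (simp add: is_cut_diagram1_def)
  then obtain index :: "'a \<Rightarrow> nat" where "inj_on index (dom C)"
    using finite_imp_inj_to_nat_seg by metis
  then have "stubs X C (\<lambda>x. real (index x))"
    using X C by unfold_locales (auto simp: inj_on_def)
  then show ?thesis
    by (rule stubs.cut_concordant_empty)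
qed

theorem lemma3p5:
  fixes X :: "('a, real) charted" and C :: "'a cut_diagram1"
  assumes "compact_oriented_curve X"
    and "space_of X homeomorphic_space top_of_set (sphere (0::complex) 1) \<or>
         space_of X homeomorphic_space top_of_set {0..1::real}"
    and "is_cut_diagram1 X C"
  shows "cut_concordant X C Map.empty"
proof -
  have "connected_space (top_of_set (sphere (0::complex) 1))"
    by (simp add: connected_space_subtopology connected_sphere)
  moreover have "connected_space (top_of_set {0..1::real})"
    by (simp add: connected_space_subtopology)
  ultimately have "connected_space (space_of X)"
    using assms(2) by (metis homeomorphic_connected_space)
  with assms(1) show ?thesis
    using assms(3) by (rule cut_concordant_empty_if_connected)
qed

end
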